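(* Let $\gamma\in(0,1/3)$ and $s\in(1/2,1)$, and let $u\in L^\infty(\mathbb{R}^n)$ be a viscosity solution of $$-(-\Delta)^su=u_+^\gamma-u_-^\gamma\quad\text{in }\mathbb{R}^n.$$ If $x_0\in\partial\{u>0\}\cap\{|Du|=0\}$, and $$u(x)=o\left(|x-x_0|^{\frac{2s}{1-\gamma}}\right)\quad\text{as } |x|\to\infty,$$ then $u\equiv0$.
   Context: $B_r(x_0)$ is the open ball in $\mathbb{R}^n$ of radius $r$ centered at $x_0$. $u_+:=\max(u,0)$, $u_-:=(-u)_+$. The fractional Laplacian, for $s\in(0,1)$, is $$(-\Delta)^su(x):=c_{n,s}\,\mathrm{P.V.}\int_{\mathbb{R}^n}\frac{u(x)-u(y)}{|x-y|^{n+2s}}\,dy,$$ with $c_{n,s}$ its normalization constant. Viscosity solutions: a function $u:\mathbb{R}^n\to\mathbb{R}$ is a viscosity subsolution (supersolution) of $-(-\Delta)^su=u_+^\gamma-u_-^\gamma$ in $\mathbb{R}^n$ if $u$ is upper (lower) semicontinuous and, whenever $x_0\in\mathbb{R}^n$, $r>0$, and $\varphi\in C^2(\overline{B_r(x_0)})$ satisfies $\varphi(x_0)=u(x_0)$ and $\varphi(y)>(<)\,u(y)$ for all $y\in B_r(x_0)\setminus\{x_0\}$, then the function $v$ equal to $\varphi$ in $B_r(x_0)$ and to $u$ in $\mathbb{R}^n\setminus B_r(x_0)$ satisfies $-(-\Delta)^sv(x_0)\ge(\le)\,v_+^\gamma(x_0)-v_-^\gamma(x_0)$. A viscosity solution is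 both a subsolution and a supersolution. *)

theory Defs
  imports "HOL-Analysis.Analysis" "HOL-Library.Landau_Symbols"
begin

text \<open>
  The usual normalization constant $c_{n,s} = 4^s \Gamma(n/2+s) / (\pi^{n/2} |\Gamma(-s)|)$, for which
  $(-\Delta)^s$ is the Fourier multiplier with symbol $|\xi|^{2s}$.
\<close>

definition frac_const :: "nat \<Rightarrow> real \<Rightarrow> real" where
  "frac_const n s =
     4 powr s * Gamma (real n / 2 + s) / (pi powr (real n / 2) * \<bar>Gamma (- s)\<bar>)"

definition frac_kernel :: "real \<Rightarrow> (real^'n \<Rightarrow> real) \<Rightarrow> real^'n \<Rightarrow> real^'n \<Rightarrow> real" where
  "frac_kernel s u x y = (u x - u y) / norm (x - y) powr (real CARD('n) + 2 * s)"

text \<open>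
  \<open>has_frac_laplacian s u x L\<close> says that $(-\Delta)^s u(x)$ is well defined and equals \<open>L\<close>. The
  principal value is the limit of the integrals over the complements of the balls $B_\epsilon(x)$,
  all of which have to exist as Lebesgue integrals. A relation avoids assigning a junk value to
  $(-\Delta)^s u(x)$ where it does not exist.
\<close>

definition has_frac_laplacian :: "real \<Rightarrow> (real^'n \<Rightarrow> real) \<Rightarrow> real^'n \<Rightarrow> real \<Rightarrow> bool" where
  "has_frac_laplacian s u x L \<longleftrightarrow>
     (\<forall>\<epsilon>>0. set_integrable lebesgue (- ball x \<epsilon>) (frac_kernel s u x)) \<and>
     ((\<lambda>\<epsilon>. frac_const CARD('n) s * (LINT y:(- ball x \<epsilon>)|lebesgue. frac_kernel s u x y))
        \<longlongrightarrow> L) (at_right 0)"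

definition upper_semicont :: "('a::topological_space \<Rightarrow> real) \<Rightarrow> bool" where
  "upper_semicont u \<longleftrightarrow> (\<forall>x. \<forall>c>u x. \<forall>\<^sub>F y in nhds x. u y < c)"

definition lower_semicont :: "('a::topological_space \<Rightarrow> real) \<Rightarrow> bool" where
  "lower_semicont u \<longleftrightarrow> (\<forall>x. \<forall>c<u x. \<forall>\<^sub>F y in nhds x. c < u y)"

text \<open>
  The space $C^2(\overline{B_r(x_0)})$: \<open>\<phi>\<close> is $C^2$ in the open ball, and \<open>\<phi>\<close>, its gradient and
  its Hessian extend continuously to the closed ball. Only the values of \<open>G\<close> and \<open>H\<close> on the
  sphere are free; they are the extensions.
\<close>

definition C2_cball :: "real^'n \<Rightarrow> real \<Rightarrow> (real^'n \<Rightarrow> real) \<Rightarrow> bool" where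
  "C2_cball x0 r \<phi> \<longleftrightarrow>
     (\<exists>(G :: real^'n \<Rightarrow> real^'n) (H :: real^'n \<Rightarrow> real^'n^'n).
        (\<forall>x\<in>ball x0 r. GDERIV \<phi> x :> G x \<and> (G has_derivative (\<lambda>h. H x *v h)) (at x)) \<and>
        continuous_on (cball x0 r) \<phi> \<and>
        continuous_on (cball x0 r) G \<and>
        continuous_on (cball x0 r) H)"

definition glue_ball :: "real^'n \<Rightarrow> real \<Rightarrow> (real^'n \<Rightarrow> real) \<Rightarrow> (real^'n \<Rightarrow> real) \<Rightarrow> real^'n \<Rightarrow> real" where
  "glue_ball x0 r \<phi> u = (\<lambda>y. if y \<in> ball x0 r then \<phi> y else u y)"

text \<open>The nonlinearity $t_+^\gamma - t_-^\gamma$, with $t_+ = \max(t,0)$ and $t_- = (-t)_+$.\<close>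

definition rhs_power :: "real \<Rightarrow> real \<Rightarrow> real" where
  "rhs_power \<gamma> t = max t 0 powr \<gamma> - max (- t) 0 powr \<gamma>"

text \<open>
  Sub- and supersolutions of $-(-\Delta)^s u = u_+^\gamma - u_-^\gamma$ in the whole space. The
  inequality for the glued function includes the claim that its fractional Laplacian at \<open>x0\<close>
  is well defined.
\<close>

definition viscosity_subsolution :: "real \<Rightarrow> real \<Rightarrow> (real^'n \<Rightarrow> real) \<Rightarrow> bool" where
  "viscosity_subsolution s \<gamma> u \<longleftrightarrow>
     upper_semicont u \<and>
     (\<forall>x0 r \<phi>. r > 0 \<and> C2_cball x0 r \<phi> \<and> \<phi> x0 = u x0 \<and> (\<forall>y\<in>ball x0 r - {x0}. \<phi> y > u y) \<longrightarrow>
        (\<exists>L. has_frac_laplacian s (glue_ball x0 r \<phi> u) x0 L \<and>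
             - L \<ge> rhs_power \<gamma> (glue_ball x0 r \<phi> u x0)))"

definition viscosity_supersolution :: "real \<Rightarrow> real \<Rightarrow> (real^'n \<Rightarrow> real) \<Rightarrow> bool" where
  "viscosity_supersolution s \<gamma> u \<longleftrightarrow>
     lower_semicont u \<and>
     (\<forall>x0 r \<phi>. r > 0 \<and> C2_cball x0 r \<phi> \<and> \<phi> x0 = u x0 \<and> (\<forall>y\<in>ball x0 r - {x0}. \<phi> y < u y) \<longrightarrow>
        (\<exists>L. has_frac_laplacian s (glue_ball x0 r \<phi> u) x0 L \<and>
             - L \<le> rhs_power \<gamma> (glue_ball x0 r \<phi> u x0)))"

definition viscosity_solution :: "real \<Rightarrow> real \<Rightarrow> (real^'n \<Rightarrow> real) \<Rightarrow> bool" where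
  "viscosity_solution s \<gamma> u \<longleftrightarrow> viscosity_subsolution s \<gamma> u \<and> viscosity_supersolution s \<gamma> u"

definition L_infinity :: "(real^'n \<Rightarrow> real) set" where
  "L_infinity = {u \<in> borel_measurable lebesgue. \<exists>C. AE x in lebesgue. \<bar>u x\<bar> \<le> C}"

end

theory Submission
  imports Defs
begin

text \<open>
  The right-hand side has the sign of \<open>u\<close>, so the maximum principle alone forces a bounded
  solution to vanish. If \<open>M = sup u > 0\<close>, then near an almost-maximum point the
  function \<open>u + 2\<delta> / (1 + |y - x1|\<^sup>2)\<close> attains its global maximum, at \<open>m\<close> say, and \<open>u m > M - \<delta>\<close>.
  There \<open>u\<close> is touched from above by a paraboloid whose coefficients are of size \<open>\<delta>\<close>; together
  with \<open>u \<le> u m + \<delta>\<close> far away this bounds \<open>(M/2)\<^sup>\<gamma>\<close> by a constant multiple of \<open>\<delta>\<close>, which is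
  absurd for small \<open>\<delta>\<close>. The same argument applies to \<open>-u\<close>.
\<close>

section \<open>Integrability of the truncated kernel\<close>

lemma term_le_suminf_ennreal: "g k \<le> (\<Sum>k. g k)" for g :: "nat \<Rightarrow> ennreal"
  using sum_le_suminf[of g "{k}"] by simp

text \<open>Each point of the support is charged to one index \<open>k\<close>, so \<open>f\<close>
  lies below the series of multiples \<open>C * 2^(a k)\<close> of indicators of balls of radius
  \<open>D * 2^(b k)\<close>. The integrals of the terms form a geometric series of ratio
  \<open>2^(a + b n)\<close>, where \<open>n\<close> is the dimension. The sign of \<open>b\<close>
  decides whether the balls shrink to the origin or exhaust the space.\<close>

lemma integrable_dyadic:
  fixes f :: "'a::euclidean_space \<Rightarrow> real" and a b C D :: real
  assumes meas: "f \<in> borel_measurable borel"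
    and nonneg: "\<And>z. 0 \<le> f z"
    and f: "\<And>z. 0 < f z \<Longrightarrow> \<exists>k. norm z < D * (2 powr b) ^ k \<and> f z \<le> C * (2 powr a) ^ k"
    and "0 \<le> C" "0 < D"
    and ab: "a + b * DIM('a) < 0"
  shows "integrable lborel f"
proof -
  let ?n = "DIM('a)"
  let ?V = "unit_ball_vol (real ?n)"
  let ?r = "2 powr (a + b * ?n)"
  let ?g = "\<lambda>k z::'a. ennreal (C * (2 powr a) ^ k) * indicator (ball 0 (D * (2 powr b) ^ k)) z"
  have g_meas: "?g k \<in> borel_measurable lborel" for k
    by (rule borel_measurable_times_ennreal[OF borel_measurable_const borel_measurable_indicator]) simp
  have r: "0 < ?r" "?r < 1" using powr_less_mono[of "a + b * ?n" 0 2] ab by auto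
  have V: "0 \<le> ?V" by simp
  have term_eq: "(\<integral>\<^sup>+ z. ?g k z \<partial>lborel) = ennreal ((C * D ^ ?n * ?V) * ?r ^ k)" for k
  proof -
    have "(\<integral>\<^sup>+ z. ?g k z \<partial>lborel)
       = ennreal (C * (2 powr a) ^ k) * emeasure lborel (ball (0::'a) (D * (2 powr b) ^ k))"
      by (simp add: nn_integral_cmult_indicator)
    also have "emeasure lborel (ball (0::'a) (D * (2 powr b) ^ k)) = ennreal (?V * (D * (2 powr b) ^ k) ^ ?n)"
      by (rule emeasure_ball) (use assms in simp)
    also have "ennreal (C * (2 powr a) ^ k) * ennreal (?V * (D * (2 powr b) ^ k) ^ ?n)
        = ennreal ((C * (2 powr a) ^ k) * (?V * (D * (2 powr b) ^ k) ^ ?n))"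
      by (rule ennreal_mult[symmetric]) (use assms V in auto)
    also have "(C * (2 powr a) ^ k) * (?V * (D * (2 powr b) ^ k) ^ ?n) = (C * D ^ ?n * ?V) * ?r ^ k"
    proof -
      have "?r = 2 powr a * (2 powr b) ^ ?n"
        by (simp add: powr_add powr_power mult.commute)
      then show ?thesis
        by (simp add: power_mult_distrib power_mult[symmetric] mult.commute[of k])
    qed
    finally show ?thesis .
  qed
  have "ennreal (f z) \<le> (\<Sum>k. ?g k z)" for z
  proof (cases "0 < f z")
    case True
    then obtain k where k: "norm z < D * (2 powr b) ^ k" "f z \<le> C * (2 powr a) ^ k"
      using f by blast
    then have "ennreal (f z) \<le> ?g k z"
      by (simp add: ennreal_leI)
    also have "\<dots> \<le> (\<Sum>k. ?g k z)" by (rule term_le_suminf_ennreal)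
    finally show ?thesis .
  qed (simp add: ennreal_neg)
  then have "(\<integral>\<^sup>+ z. ennreal (f z) \<partial>lborel) \<le> (\<integral>\<^sup>+ z. (\<Sum>k. ?g k z) \<partial>lborel)"
    by (intro nn_integral_mono)
  also have "\<dots> = (\<Sum>k. \<integral>\<^sup>+ z. ?g k z \<partial>lborel)"
    by (rule nn_integral_suminf[OF g_meas])
  also have "\<dots> = (\<Sum>k. ennreal ((C * D ^ ?n * ?V) * ?r ^ k))"
    by (simp only: term_eq)
  also have "\<dots> = ennreal (\<Sum>k. (C * D ^ ?n * ?V) * ?r ^ k)"
  proof (rule suminf_ennreal2)
    show "0 \<le> (C * D ^ ?n * ?V) * ?r ^ k" for k
      by (intro mult_nonneg_nonneg zero_le_power less_imp_le[OF r(1)] V \<open>0 \<le> C\<close> less_imp_le[OF \<open>0 < D\<close>])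
    have "norm ?r < 1" by (simp only: real_norm_def abs_of_pos[OF r(1)] r(2))
    then show "summable (\<lambda>k. (C * D ^ ?n * ?V) * ?r ^ k)"
      by (intro summable_mult summable_geometric)
  qed
  also have "\<dots> < \<infinity>" by (simp only: ennreal_less_top infinity_ennreal_def)
  finally show ?thesis
    using meas nonneg by (simp add: integrable_iff_bounded)
qed

text \<open>With \<open>n = CARD('n)\<close>, the function is \<open>|z|^(2 - n - 2s)\<close> near
  the origin, integrable because s < 1, and \<open>|z|^(-n - 2s)\<close> at infinity, integrable
  because s > 0.\<close>

lemma integrable_truncated_square_kernel:
  fixes s :: real
  assumes "1/2 < s" "s < 1"
  shows "integrable lborel
     (\<lambda>z::real^'n. min 1 ((norm z)\<^sup>2) / norm z powr (real CARD('n) + 2 * s))"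
proof -
  let ?p = "real CARD('n) + 2 * s"
  let ?in = "\<lambda>z::real^'n. (if norm z < 1 then (norm z)\<^sup>2 / norm z powr ?p else 0)"
  let ?out = "\<lambda>z::real^'n. (if norm z < 1 then 0 else 1 / norm z powr ?p)"
  have n: "1 \<le> real CARD('n)" by (simp add: Suc_le_eq)
  have "integrable lborel ?in"
  \<comment> \<open>The shells are \<open>2^(-k-1) < |z| <= 2^(-k)\<close>. The inner radius bounds
    the power of the norm, whence \<open>C = 2^(?p - 2)\<close>; \<open>D = 2\<close> puts the
    closed outer radius inside an open ball. The ratio exponent \<open>a + b n\<close> is 2s -
    2.\<close>
  proof (rule integrable_dyadic[where a="?p - 2" and b="-1" and C="2 powr (?p - 2)" and D=2])
    fix z :: "real^'n"
    assume "0 < ?in z"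
    then have z: "0 < norm z" "norm z < 1" by (auto split: if_splits)
    let ?l = "- log 2 (norm z)"
    define k where "k = nat \<lfloor>?l\<rfloor>"
    have "?l \<ge> 0" using z by simp
    then have k: "real k \<le> ?l" "?l < real k + 1" by (auto simp: k_def)
    have nz: "norm z = 2 powr (log 2 (norm z))" using z by simp
    have "norm z \<le> 2 powr (- real k)"
      by (subst nz) (use k in simp)
    also have "\<dots> < 2 * 2 powr (- real k)" by simp
    also have "\<dots> = 2 * (2 powr -1) ^ k" by (simp only: powr_power) simp
    finally have 1: "norm z < 2 * (2 powr -1) ^ k" .
    have "?in z = norm z powr 2 / norm z powr ?p"
      using z by simp
    also have "\<dots> = norm z powr (2 - ?p)"
      by (simp only: powr_diff)
    also have "\<dots> = 2 powr (log 2 (norm z) * (2 - ?p))"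
      by (subst nz) (simp only: powr_powr)
    also have "\<dots> \<le> 2 powr ((real k + 1) * (?p - 2))"
    proof -
      \<comment> \<open>Monotonicity needs \<open>?p - 2\<close> nonnegative; in dimension one it
        equals 2s - 1, so this is where s > 1/2 enters.\<close>
      have "?l * (?p - 2) \<le> (real k + 1) * (?p - 2)"
        by (intro mult_right_mono) (use k n assms in linarith)+
      moreover have "log 2 (norm z) * (2 - ?p) = ?l * (?p - 2)"
        by (simp only: mult_minus_left mult_minus_right[symmetric] minus_diff_eq)
      ultimately show ?thesis by (intro powr_mono) simp_all
    qed
    also have "\<dots> = 2 powr (?p - 2) * (2 powr (?p - 2)) ^ k"
      by (simp only: powr_power powr_add[symmetric] distrib_right mult_1 add.commute mult.commute)
    finally show "\<exists>k. norm z < 2 * (2 powr -1) ^ k \<and> ?in z \<le> 2 powr (?p - 2) * (2 powr (?p - 2)) ^ k"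
      using 1 by blast
  next
    show "?in \<in> borel_measurable borel" by measurable
  qed (use assms in simp_all)
  moreover have "integrable lborel ?out"
  \<comment> \<open>Now the shells are \<open>2^k <= |z| < 2^(k+1)\<close>: the inner radius gives
    the bound with \<open>C = 1\<close>, the outer one gives \<open>D = 2\<close>. The ratio
    exponent is -2s.\<close>
  proof (rule integrable_dyadic[where a="- ?p" and b=1 and C=1 and D=2])
    fix z :: "real^'n"
    assume "0 < ?out z"
    then have z: "1 \<le> norm z" "0 < norm z" by (auto split: if_splits)
    let ?l = "log 2 (norm z)"
    define k where "k = nat \<lfloor>?l\<rfloor>"
    have "?l \<ge> 0" using z by simp
    then have k: "real k \<le> ?l" "?l < real k + 1" by (auto simp: k_def)
    have nz: "norm z = 2 powr ?l" using z by simp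
    have "norm z < 2 powr (real k + 1)"
      by (subst nz) (use k in simp)
    also have "\<dots> = 2 * (2 powr 1) ^ k" by (simp add: powr_add powr_realpow)
    finally have 1: "norm z < 2 * (2 powr 1) ^ k" .
    have "?out z = norm z powr (- ?p)"
      using z by (simp only: powr_minus_divide not_less[symmetric] if_False)
    also have "\<dots> = 2 powr (?l * (- ?p))"
      by (subst nz) (simp only: powr_powr)
    also have "\<dots> \<le> 2 powr (real k * (- ?p))"
    proof -
      have "real k * ?p \<le> ?l * ?p"
        by (intro mult_right_mono) (use k n assms in linarith)+
      then have "?l * (- ?p) \<le> real k * (- ?p)" by (simp only: mult_minus_right neg_le_iff_le)
      then show ?thesis by (rule powr_mono) simp
    qed
    also have "\<dots> = 1 * (2 powr (- ?p)) ^ k"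
      by (simp only: powr_power mult_1 mult.commute)
    finally show "\<exists>k. norm z < 2 * (2 powr 1) ^ k \<and> ?out z \<le> 1 * (2 powr (- ?p)) ^ k"
      using 1 by blast
  next
    show "?out \<in> borel_measurable borel" by measurable
  qed (use assms in simp_all)
  ultimately have "integrable lborel (\<lambda>z. ?in z + ?out z)" by (rule Bochner_Integration.integrable_add)
  also have "(\<lambda>z. ?in z + ?out z) = (\<lambda>z. min 1 ((norm z)\<^sup>2) / norm z powr ?p)"
  proof
    fix z :: "real^'n"
    have "norm z < 1 \<Longrightarrow> (norm z)\<^sup>2 \<le> 1" "\<not> norm z < 1 \<Longrightarrow> 1 \<le> (norm z)\<^sup>2"
      by (simp_all add: abs_square_le_1 one_le_power)
    then show "?in z + ?out z = min 1 ((norm z)\<^sup>2) / norm z powr ?p"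
      by (cases "norm z < 1") (simp_all only: if_True if_False not_False_eq_True simp_thms min_absorb1 min_absorb2 add_0_left add_0_right)
  qed
  finally show ?thesis .
qed

section \<open>Test functions and the symmetry under negation\<close>

lemma C2_cball_uminus:
  assumes "C2_cball x0 r \<phi>"
  shows "C2_cball x0 r (\<lambda>y. - \<phi> y)"
proof -
  obtain G H where GH: "\<forall>x\<in>ball x0 r. GDERIV \<phi> x :> G x \<and> (G has_derivative (\<lambda>h. H x *v h)) (at x)"
    "continuous_on (cball x0 r) \<phi>" "continuous_on (cball x0 r) G" "continuous_on (cball x0 r) H"
    using assms unfolding C2_cball_def by blast
  show ?thesis
    unfolding C2_cball_def
  proof (intro exI conjI ballI)
    fix x assume x: "x \<in> ball x0 r"
    show "GDERIV (\<lambda>y. - \<phi> y) x :> - G x" using GH x by (intro GDERIV_minus) auto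
    have "((\<lambda>y. - G y) has_derivative (\<lambda>h. - (H x *v h))) (at x)"
      using GH x by (intro derivative_intros) auto
    moreover have "(\<lambda>h. - (H x *v h)) = (\<lambda>h. (- H x) *v h)"
      using matrix_vector_mult_diff_rdistrib[of 0 "H x"] by simp
    ultimately show "((\<lambda>y. - G y) has_derivative (\<lambda>h. (- H x) *v h)) (at x)" by simp
  qed (use GH in \<open>auto intro!: continuous_intros\<close>)
qed

text \<open>The maximum principle below tests the equation with such paraboloids only; the gradient
  is affine and the Hessian is the constant matrix \<open>mat (2 * k)\<close>.\<close>

lemma C2_cball_quadratic:
  "C2_cball x0 r (\<lambda>y. c + p \<bullet> (y - x0) + k * (norm (y - x0))\<^sup>2)"
proof -
  have "GDERIV (\<lambda>y. c + p \<bullet> (y - x0) + k * (norm (y - x0))\<^sup>2) x :> p + (2 * k) *\<^sub>R (x - x0)" for x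
    unfolding gderiv_def power2_norm_eq_inner
    by (auto intro!: derivative_eq_intros simp: inner_commute algebra_simps)
  moreover have "((\<lambda>x. p + (2 * k) *\<^sub>R (x - x0)) has_derivative (\<lambda>h. mat (2 * k) *v h)) (at x)" for x
  proof -
    have *: "(\<lambda>h::real^'n. mat (2 * k) *v h) = (\<lambda>h. (2 * k) *\<^sub>R h)"
      by (auto simp: fun_eq_iff mat_def matrix_vector_mult_def vec_eq_iff if_distrib[where f="\<lambda>x. x * _"] sum.delta cong: if_cong)
    have "((\<lambda>x. p + (2 * k) *\<^sub>R (x - x0)) has_derivative (\<lambda>h. (2 * k) *\<^sub>R h)) (at x)"
      by (auto intro!: derivative_eq_intros)
    then show ?thesis unfolding * .
  qed
  ultimately show ?thesis
    unfolding C2_cball_def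
    by (intro exI[of _ "\<lambda>x. p + (2 * k) *\<^sub>R (x - x0)"] exI[of _ "\<lambda>x. mat (2 * k)"])
      (auto intro!: continuous_intros)
qed

lemma has_frac_laplacian_uminus:
  assumes "has_frac_laplacian s u x L"
  shows "has_frac_laplacian s (\<lambda>y. - u y) x (- L)"
proof -
  have *: "frac_kernel s (\<lambda>y. - u y) x = (\<lambda>y. - frac_kernel s u x y)"
    by (auto simp: fun_eq_iff frac_kernel_def minus_divide_left)
  show ?thesis
    using assms unfolding has_frac_laplacian_def *
    by (auto simp: set_integrable_def set_lebesgue_integral_def intro: tendsto_minus)
qed

text \<open>The operator is linear and the nonlinearity is odd, so negating a test function that
  touches \<open>- u\<close> from above gives one that touches \<open>u\<close> from below.\<close>

lemma viscosity_subsolution_uminus: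
  assumes "viscosity_supersolution s \<gamma> u"
  shows "viscosity_subsolution s \<gamma> (\<lambda>x. - u x)"
  unfolding viscosity_subsolution_def
proof (intro conjI allI impI)
  show "upper_semicont (\<lambda>x. - u x)"
    unfolding upper_semicont_def
  proof (intro allI impI)
    fix x c assume "c > - u x"
    then have "\<forall>\<^sub>F y in nhds x. - c < u y"
      using assms unfolding viscosity_supersolution_def lower_semicont_def by auto
    then show "\<forall>\<^sub>F y in nhds x. - u y < c" by eventually_elim simp
  qed
  fix x0 r \<phi>
  assume A: "r > 0 \<and> C2_cball x0 r \<phi> \<and> \<phi> x0 = - u x0 \<and> (\<forall>y\<in>ball x0 r - {x0}. - u y < \<phi> y)"
  have B: "0 < r \<and> C2_cball x0 r (\<lambda>y. - \<phi> y) \<and> - \<phi> x0 = u x0 \<and> (\<forall>y\<in>ball x0 r - {x0}. - \<phi> y < u y)"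
    using A C2_cball_uminus[of x0 r \<phi>] by force
  obtain L where L: "has_frac_laplacian s (glue_ball x0 r (\<lambda>y. - \<phi> y) u) x0 L"
    "- L \<le> rhs_power \<gamma> (glue_ball x0 r (\<lambda>y. - \<phi> y) u x0)"
    using assms B unfolding viscosity_supersolution_def by blast
  have "(\<lambda>y. - glue_ball x0 r (\<lambda>y. - \<phi> y) u y) = glue_ball x0 r \<phi> (\<lambda>x. - u x)"
    by (auto simp: glue_ball_def)
  then have 1: "has_frac_laplacian s (glue_ball x0 r \<phi> (\<lambda>x. - u x)) x0 (- L)"
    using has_frac_laplacian_uminus[OF L(1)] by simp
  have "rhs_power \<gamma> (glue_ball x0 r \<phi> (\<lambda>x. - u x) x0) \<le> - (- L)"
    using L(2) A by (auto simp: glue_ball_def rhs_power_def)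
  with 1 show "\<exists>L. has_frac_laplacian s (glue_ball x0 r \<phi> (\<lambda>x. - u x)) x0 L \<and>
      rhs_power \<gamma> (glue_ball x0 r \<phi> (\<lambda>x. - u x) x0) \<le> - L" by blast
qed

section \<open>A one-sided bound for the fractional Laplacian at a point\<close>

lemma lborel_distr_uminus_euclidean:
  "distr lborel borel uminus = (lborel :: 'a::euclidean_space measure)"
  using lborel_affine[of "-1" "0::'a"] by (simp add: density_1)

text \<open>The linear part of the bound is odd about \<open>x\<close>, so it integrates to zero over
  the symmetric domain.\<close>

lemma frac_laplacian_lower_bound:
  fixes v :: "real^'n \<Rightarrow> real" and x p :: "real^'n"
  assumes "1/2 < s" "s < 1"
    and L: "has_frac_laplacian s v x L"
    and v: "\<And>y. v y - v x \<le> (if norm (y - x) < 1 then p \<bullet> (y - x) else 0) + K * min 1 ((norm (y - x))\<^sup>2)"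
    and "0 \<le> K"
  shows "- L \<le> frac_const CARD('n) s * K *
     (LINT z|lborel. min 1 ((norm (z::real^'n))\<^sup>2) / norm z powr (real CARD('n) + 2 * s))"
proof -
  let ?p = "real CARD('n) + 2 * s"
  let ?w = "\<lambda>z::real^'n. min 1 ((norm z)\<^sup>2) / norm z powr ?p"
  have pp: "0 < ?p" using assms by simp
  have c: "0 \<le> frac_const CARD('n) s"
    using assms by (simp add: frac_const_def Gamma_real_nonneg)
  have wint: "integrable lborel ?w"
    by (rule integrable_truncated_square_kernel) fact+
  \<comment> \<open>The right-hand side is independent of \<epsilon>, so the bound passes to the
    limit defining the principal value.\<close>
  have bound: "- (LINT y:(- ball x \<epsilon>)|lebesgue. frac_kernel s v x y) \<le> K * (LINT z|lborel. ?w z)"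
    if "0 < \<epsilon>" for \<epsilon>
  proof -
    \<comment> \<open>The linear term divided by the kernel weight need not be integrable at the
      origin. On this annulus it is bounded, and the annulus is invariant under negation. If
      \<epsilon> is at least 1, the annulus is empty.\<close>
    let ?odd = "\<lambda>z::real^'n. indicator (ball 0 1 - ball 0 \<epsilon>) z * ((p \<bullet> z) / norm z powr ?p)"
    have intk: "set_integrable lebesgue (- ball x \<epsilon>) (frac_kernel s v x)"
      using L that unfolding has_frac_laplacian_def by blast
    have odd_meas [measurable]: "?odd \<in> borel_measurable borel"
      by (intro borel_measurable_times borel_measurable_indicator borel_measurable_divide
          powr_real_measurable borel_measurable_norm borel_measurable_inner) auto
    have odd_int: "integrable lborel ?odd"
    proof (rule Bochner_Integration.integrable_bound)
      show "integrable lborel (\<lambda>z::real^'n. norm p / \<epsilon> powr ?p * indicator (ball 0 1) z)"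
        by (intro integrable_mult_right integrable_real_indicator) 
          (auto simp: emeasure_ball)
      show "AE z in lborel. norm (?odd z) \<le> norm (norm p / \<epsilon> powr ?p * indicator (ball 0 1) z)"
      proof (intro AE_I2)
        fix z :: "real^'n"
        show "norm (?odd z) \<le> norm (norm p / \<epsilon> powr ?p * indicator (ball 0 1) z)"
        proof (cases "z \<in> ball 0 1 - ball 0 \<epsilon>")
          case True
          then have z: "\<epsilon> \<le> norm z" "norm z < 1" by auto
          have "\<bar>p \<bullet> z\<bar> \<le> norm p * norm z" by (rule Cauchy_Schwarz_ineq2)
          also have "\<dots> \<le> norm p" using z by (simp add: mult_left_le)
          finally have "\<bar>p \<bullet> z\<bar> / norm z powr ?p \<le> norm p / \<epsilon> powr ?p"
            using z that pp by (intro frac_le powr_mono2) auto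
          then show ?thesis using True by simp
        qed auto
      qed
    qed (use odd_meas in simp)
    have odd0: "(LINT z|lborel. ?odd z) = 0"
    proof -
      have "(LINT z|lborel. ?odd z) = (LINT z|lborel. ?odd (- z))"
      proof -
        have "(LINT z|lborel. ?odd z) = (LINT z|distr lborel borel uminus. ?odd z)"
          by (simp add: lborel_distr_uminus_euclidean)
        also have "\<dots> = (LINT z|lborel. ?odd (- z))"
          by (rule integral_distr[OF _ odd_meas]) measurable
        finally show ?thesis .
      qed
      also have "(\<lambda>z. ?odd (- z)) = (\<lambda>z. - ?odd z)"
        by (auto simp: fun_eq_iff indicator_def)
      finally show ?thesis by simp
    qed
    let ?h = "\<lambda>z. ?odd z + K * ?w z"
    have h_int: "integrable lborel ?h"
      by (intro Bochner_Integration.integrable_add odd_int integrable_mult_right wint)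
    have h_meas: "?h \<in> borel_measurable borel"
      using borel_measurable_integrable[OF h_int] by simp
    have h_val: "(LINT z|lborel. ?h z) = K * (LINT z|lborel. ?w z)"
      using Bochner_Integration.integral_add[OF odd_int integrable_mult_right[OF wint, of K]]
      by (simp only: odd0 integral_mult_right_zero add_0_left)
    have sh_int: "integrable lborel (\<lambda>y. ?h (y - x))"
    proof -
      have "integrable (distr lborel borel (\<lambda>y. - x + y)) ?h"
        unfolding lborel_distr_plus by (rule h_int)
      then show ?thesis using h_meas by (subst (asm) integrable_distr_eq) auto
    qed
    have sh_val: "(LINT y|lborel. ?h (y - x)) = (LINT z|lborel. ?h z)"
    proof -
      have "(LINT z|lborel. ?h z) = (LINT z|distr lborel borel (\<lambda>y. - x + y). ?h z)"
        unfolding lborel_distr_plus ..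
      also have "\<dots> = (LINT y|lborel. ?h (- x + y))"
        by (rule integral_distr[OF _ h_meas]) measurable
      finally show ?thesis by simp
    qed
    have "- (LINT y:(- ball x \<epsilon>)|lebesgue. frac_kernel s v x y)
        = (LINT y|lebesgue. - (indicator (- ball x \<epsilon>) y *\<^sub>R frac_kernel s v x y))"
      by (simp add: set_lebesgue_integral_def)
    also have "\<dots> \<le> (LINT y|lebesgue. ?h (y - x))"
    proof (rule integral_mono)
      show "integrable lebesgue (\<lambda>y. - (indicator (- ball x \<epsilon>) y *\<^sub>R frac_kernel s v x y))"
        using intk by (simp add: set_integrable_def)
      show "integrable lebesgue (\<lambda>y. ?h (y - x))"
        using sh_int by (subst integrable_completion) auto
      fix y
      show "- (indicator (- ball x \<epsilon>) y *\<^sub>R frac_kernel s v x y) \<le> ?h (y - x)"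
      proof (cases "y \<in> ball x \<epsilon>")
        \<comment> \<open>In the removed ball the left side and the odd part vanish, while the
          quadratic part, kept on the whole space, is nonnegative.\<close>
        case True
        then have "y - x \<in> ball 0 \<epsilon>" by (simp add: dist_norm norm_minus_commute)
        then show ?thesis using True \<open>0 \<le> K\<close> by simp
      next
        case False
        then have y: "y - x \<notin> ball 0 \<epsilon>" by (simp add: dist_norm norm_minus_commute)
        have "- frac_kernel s v x y = (v y - v x) / norm (y - x) powr ?p"
          by (simp add: frac_kernel_def norm_minus_commute minus_divide_left)
        also have "\<dots> \<le> ((if norm (y - x) < 1 then p \<bullet> (y - x) else 0)
            + K * min 1 ((norm (y - x))\<^sup>2)) / norm (y - x) powr ?p"
          by (intro divide_right_mono v) simp
        also have "\<dots> = ?h (y - x)"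
          using y by (simp add: add_divide_distrib)
        finally show ?thesis using False by simp
      qed
    qed
    \<comment> \<open>The principal value is defined over \<open>lebesgue\<close>, but translation
      and reflection were carried out in \<open>lborel\<close>. The two integrals agree because the
      majorant is Borel.\<close>
    also have "\<dots> = (LINT y|lborel. ?h (y - x))"
      using sh_int by (intro integral_completion) auto
    finally show ?thesis using sh_val h_val by simp
  qed
  have lim: "((\<lambda>\<epsilon>. - (frac_const CARD('n) s * (LINT y:(- ball x \<epsilon>)|lebesgue. frac_kernel s v x y)))
        \<longlongrightarrow> - L) (at_right 0)"
    using L unfolding has_frac_laplacian_def by (intro tendsto_minus) blast
  have "- (frac_const CARD('n) s * (LINT y:(- ball x \<epsilon>)|lebesgue. frac_kernel s v x y))
      \<le> frac_const CARD('n) s * K * (LINT z|lborel. ?w z)" if "0 < \<epsilon>" for \<epsilon>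
    using mult_left_mono[OF bound[OF that] c] by (simp add: mult.assoc)
  then have "\<forall>\<^sub>F \<epsilon> in at_right 0. - (frac_const CARD('n) s * (LINT y:(- ball x \<epsilon>)|lebesgue. frac_kernel s v x y))
      \<le> frac_const CARD('n) s * K * (LINT z|lborel. ?w z)"
    by (auto simp: eventually_at_filter)
  then show ?thesis
    by (rule tendsto_upperbound[OF lim]) simp
qed

section \<open>The maximum principle for bounded subsolutions\<close>

text \<open>A tangent paraboloid for the bump whose quadratic coefficient does not depend on the
  base point. If \<open>t\<close> is the increment of the squared norm, then
  \<open>1/A - 1/(A + t)\<close> equals \<open>t/A^2\<close> minus a nonnegative remainder, and
  \<open>A >= 1\<close> removes the factor in front of the squared norm of \<open>z\<close>.\<close>

lemma inverse_quadratic_tangent_bound: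
  fixes x z :: "'a::real_inner"
  defines "A \<equiv> 1 + (norm x)\<^sup>2"
  shows "1 / A - 1 / (1 + (norm (x + z))\<^sup>2) \<le> (2 / A\<^sup>2) * (x \<bullet> z) + (norm z)\<^sup>2"
proof -
  define t where "t = 2 * (x \<bullet> z) + (norm z)\<^sup>2"
  have A: "1 \<le> A" by (simp add: A_def)
  have B: "1 + (norm (x + z))\<^sup>2 = A + t"
    unfolding A_def t_def power2_norm_eq_inner by (simp add: inner_simps inner_commute)
  have Bpos: "0 < A + t" using B by (metis add_pos_nonneg zero_le_power2 zero_less_one)
  have "1 / A - 1 / (A + t) = t / A\<^sup>2 - t\<^sup>2 / (A\<^sup>2 * (A + t))"
    using A Bpos by (simp add: divide_simps power2_eq_square) (simp add: algebra_simps)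
  also have "\<dots> \<le> t / A\<^sup>2" using Bpos by simp
  also have "\<dots> = (2 / A\<^sup>2) * (x \<bullet> z) + (norm z)\<^sup>2 / A\<^sup>2"
    by (simp add: t_def add_divide_distrib)
  also have "\<dots> \<le> (2 / A\<^sup>2) * (x \<bullet> z) + (norm z)\<^sup>2"
    using A by (simp add: divide_le_eq mult_left_le one_le_power mult_le_cancel_left1)
  finally show ?thesis by (simp add: B)
qed

text \<open>The assumptions are one-sided apart from continuity, so that the result can be applied
  to \<open>u\<close> and to \<open>- u\<close> alike.\<close>

lemma bounded_viscosity_subsolution_nonpos:
  fixes u :: "real^'n \<Rightarrow> real"
  assumes "0 < \<gamma>" "1/2 < s" "s < 1"
    and sub: "viscosity_subsolution s \<gamma> u"
    and cont: "continuous_on UNIV u"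
    and bdd: "bdd_above (range u)"
  shows "u x \<le> 0"
proof (rule ccontr)
  assume "\<not> u x \<le> 0"
  define M where "M = (SUP x. u x)"
  have uM: "u y \<le> M" for y unfolding M_def using bdd by (intro cSUP_upper) auto
  with \<open>\<not> u x \<le> 0\<close> have M: "0 < M" by (meson not_le less_le_trans)
  define I where "I = (LINT z|lborel. min 1 ((norm (z::real^'n))\<^sup>2) / norm z powr (real CARD('n) + 2 * s))"
  \<comment> \<open>The restriction \<delta> \<le> M/2 turns \<open>u m > M - \<delta>\<close> into
    \<open>u m > M/2\<close>, so the left side stays fixed as \<delta> tends to 0.\<close>
  have est: "(M / 2) powr \<gamma> \<le> frac_const CARD('n) s * (4 * \<delta>) * I" if d: "0 < \<delta>" "\<delta> \<le> M / 2" for \<delta>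
  proof -
    obtain x1 where x1: "M - \<delta> < u x1"
      using less_cSUP_iff[of UNIV u "M - \<delta>"] bdd d by (auto simp: M_def)
    let ?q = "\<lambda>y. 1 / (1 + (norm (y - x1))\<^sup>2)"
    \<comment> \<open>The bump adds 2\<delta> at \<open>x1\<close>, where \<open>u\<close> falls
      short of \<open>M\<close> by less than \<delta>, but at most \<delta> outside the unit ball
      around \<open>x1\<close>. Hence \<open>?w x1 > M + \<delta>\<close> beats every value outside,
      and a maximum over the compact ball is global.\<close>
    let ?w = "\<lambda>y. u y + 2 * \<delta> * ?q y"
    have ne: "1 + (norm (y - x1))\<^sup>2 \<noteq> 0" for y
      by (metis add_pos_nonneg zero_le_power2 zero_less_one less_irrefl)
    have "\<exists>m\<in>cball x1 1. \<forall>y\<in>cball x1 1. ?w y \<le> ?w m"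
      using continuous_on_subset[OF cont] ne
      by (intro continuous_attains_sup compact_cball) (auto intro!: continuous_intros)
    then obtain m where m: "\<And>y. y \<in> cball x1 1 \<Longrightarrow> ?w y \<le> ?w m" by blast
    have wm: "M + \<delta> < ?w m" using m[of x1] x1 by simp
    have max: "?w y \<le> ?w m" for y
    proof (cases "y \<in> cball x1 1")
      case False
      then have "1 \<le> (norm (y - x1))\<^sup>2"
        by (intro one_le_power) (simp add: dist_norm norm_minus_commute)
      then have "?q y \<le> 1 / 2" by (intro divide_left_mono) auto
      then have "2 * \<delta> * ?q y \<le> \<delta>" using mult_left_mono[of "?q y" "1/2" "2 * \<delta>"] d by simp
      then show ?thesis using uM[of y] wm by linarith
    qed (rule m)
    have q01: "0 \<le> ?q y" "?q y \<le> 1" for y by (simp_all add: divide_le_eq add_pos_nonneg)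
    have um: "M - \<delta> < u m"
      using wm mult_left_mono[OF q01(2)[of m], of "2 * \<delta>"] d by simp
    \<comment> \<open>This is minus the gradient of \<open>2 * \<delta> * ?q\<close> at
      \<open>m\<close>.\<close>
    define p where "p = (4 * \<delta> / (1 + (norm (m - x1))\<^sup>2)\<^sup>2) *\<^sub>R (m - x1)"
    have tang: "u y - u m \<le> p \<bullet> (y - m) + 2 * \<delta> * (norm (y - m))\<^sup>2" for y
    proof -
      have "u y - u m \<le> 2 * \<delta> * (?q m - ?q y)"
        using max[of y] by (simp add: algebra_simps)
      also have "\<dots> \<le> 2 * \<delta> * ((2 / (1 + (norm (m - x1))\<^sup>2)\<^sup>2) * ((m - x1) \<bullet> (y - m)) + (norm (y - m))\<^sup>2)"
        using inverse_quadratic_tangent_bound[of "m - x1" "y - m"] d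
        by (intro mult_left_mono) auto
      also have "\<dots> = p \<bullet> (y - m) + 2 * \<delta> * (norm (y - m))\<^sup>2"
        by (simp add: p_def distrib_left)
      finally show ?thesis .
    qed
    have far: "u y - u m \<le> 2 * \<delta>" for y
      using uM[of y] um d by simp
    \<comment> \<open>The coefficient 2\<delta> of \<open>tang\<close> is doubled to make the
      contact at \<open>m\<close> strict.\<close>
    let ?\<phi> = "\<lambda>y. u m + p \<bullet> (y - m) + (4 * \<delta>) * (norm (y - m))\<^sup>2"
    let ?v = "glue_ball m 1 ?\<phi> u"
    have vm: "?v m = u m" by (simp add: glue_ball_def)
    have "u y < ?\<phi> y" if "y \<noteq> m" for y
    proof -
      have "0 < \<delta> * (norm (y - m))\<^sup>2" using that d by simp
      then show ?thesis using tang[of y] by linarith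
    qed
    then have "(0::real) < 1 \<and> C2_cball m 1 ?\<phi> \<and> ?\<phi> m = u m \<and> (\<forall>y\<in>ball m 1 - {m}. u y < ?\<phi> y)"
      using C2_cball_quadratic[of m 1 "u m" p "4 * \<delta>"] by simp
    then obtain L where L: "has_frac_laplacian s ?v m L" "rhs_power \<gamma> (?v m) \<le> - L"
      using sub unfolding viscosity_subsolution_def by blast
    \<comment> \<open>Inside the unit ball 4\<delta> is the quadratic coefficient of the test
      function itself; outside, where the minimum is 1, it covers the bound 2\<delta> of
      \<open>far\<close>.\<close>
    have vb: "?v y - ?v m \<le> (if norm (y - m) < 1 then p \<bullet> (y - m) else 0) + (4 * \<delta>) * min 1 ((norm (y - m))\<^sup>2)" for y
    proof (cases "norm (y - m) < 1")
      case True
      then have "(norm (y - m))\<^sup>2 \<le> 1" by (simp add: abs_square_le_1)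
      then show ?thesis using True vm by (simp add: glue_ball_def dist_norm norm_minus_commute)
    next
      case False
      then have "1 \<le> (norm (y - m))\<^sup>2" by (simp add: one_le_power)
      then show ?thesis using False vm far[of y] d by (simp add: glue_ball_def dist_norm norm_minus_commute)
    qed
    have "- L \<le> frac_const CARD('n) s * (4 * \<delta>) * I"
      unfolding I_def using d by (intro frac_laplacian_lower_bound[OF assms(2,3) L(1) vb]) simp
    moreover have "(M / 2) powr \<gamma> \<le> rhs_power \<gamma> (?v m)"
      unfolding vm rhs_power_def using um d M \<open>0 < \<gamma>\<close> by (auto intro!: powr_mono2)
    ultimately show ?thesis using L(2) by linarith
  qed
  have "((\<lambda>\<delta>. frac_const CARD('n) s * (4 * \<delta>) * I) \<longlongrightarrow> frac_const CARD('n) s * (4 * 0) * I) (at_right 0)"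
    by (intro tendsto_intros)
  moreover have "\<forall>\<^sub>F \<delta> in at_right 0. (M / 2) powr \<gamma> \<le> frac_const CARD('n) s * (4 * \<delta>) * I"
    using eventually_at_right_real[of 0 "M / 2"] M
    by (auto elim!: eventually_mono intro!: est)
  ultimately have "(M / 2) powr \<gamma> \<le> frac_const CARD('n) s * (4 * 0) * I"
    by (rule tendsto_lowerbound) simp
  then show False using M by simp
qed

section \<open>From essential to pointwise bounds, and the conclusion\<close>

lemma continuous_on_semicont:
  fixes u :: "'a::t2_space \<Rightarrow> real"
  assumes "upper_semicont u" "lower_semicont u"
  shows "continuous_on UNIV u"
proof -
  have "isCont u x" for x
    unfolding continuous_at order_tendsto_iff
    using assms unfolding upper_semicont_def lower_semicont_def eventually_at_filter
    by (auto elim!: eventually_mono)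
  then show ?thesis by (simp add: continuous_on_eq_continuous_at)
qed

text \<open>The set where \<open>f\<close> exceeds \<open>c\<close> is open and null, hence empty.
  This turns the essential bound in \<open>L_infinity\<close> into one valid at every point, as the
  supremum argument requires.\<close>

lemma continuous_AE_le:
  fixes f :: "'a::euclidean_space \<Rightarrow> real"
  assumes "continuous_on UNIV f" "AE x in lebesgue. f x \<le> c"
  shows "f x \<le> c"
proof -
  have op: "open {x. c < f x}"
    using assms(1) by (intro open_Collect_less continuous_intros)
  then have "negligible {x. c < f x}"
    unfolding negligible_iff_null_sets
    using assms(2) op lborelD[OF borel_open[OF op]]
    by (subst AE_iff_null_sets) (auto simp: not_less)
  then have "{x. c < f x} = {}" using op open_not_negligible by blast
  then show ?thesis by (auto simp: not_less)
qed

theorem theorem5p3: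
  fixes u :: "real^'n \<Rightarrow> real" and x0 :: "real^'n" and \<gamma> s :: real
  assumes "0 < \<gamma>" "\<gamma> < 1/3"
    and "1/2 < s" "s < 1"
    and "u \<in> L_infinity"
    and "viscosity_solution s \<gamma> u"
    and "x0 \<in> frontier {x. u x > 0}"
    and "GDERIV u x0 :> 0"
    and "u \<in> o[at_infinity](\<lambda>x. norm (x - x0) powr (2 * s / (1 - \<gamma>)))"
  shows "\<forall>x. u x = 0"
proof -
  have sub: "viscosity_subsolution s \<gamma> u" and super: "viscosity_supersolution s \<gamma> u"
    using assms(6) by (simp_all add: viscosity_solution_def)
  then have cont: "continuous_on UNIV u"
    by (intro continuous_on_semicont)
      (simp_all add: viscosity_subsolution_def viscosity_supersolution_def)
  obtain C where "AE x in lebesgue. \<bar>u x\<bar> \<le> C"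
    using assms(5) by (auto simp: L_infinity_def)
  then have C: "\<bar>u x\<bar> \<le> C" for x
    using cont by (intro continuous_AE_le[where f="\<lambda>x. \<bar>u x\<bar>"] continuous_intros)
  have "u x \<le> 0" for x
    using C by (intro bounded_viscosity_subsolution_nonpos[OF assms(1,3,4) sub cont] bdd_aboveI2[of _ _ C])
      (auto simp: abs_le_iff)
  moreover have "- u x \<le> 0" for x
    using C cont
    by (intro bounded_viscosity_subsolution_nonpos[OF assms(1,3,4) viscosity_subsolution_uminus[OF super]]
        bdd_aboveI2[of _ _ C] continuous_intros) (auto simp: abs_le_iff)
  ultimately show ?thesis by (simp add: antisym)
qed

end
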